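(* For every positive integer $n$, the member $\mathbb{V}_n$ of the Vyalyi family of graphs satisfies $\operatorname{pf}(\mathbb{V}_n) \geq 3n+1$.
   Context: Graphs are finite and simple. Given an orientation $D$ of a graph $G$ with vertices enumerated $1,\dots,2m$ and a perfect matching $M$ of $G$, $\operatorname{sign}_D(M)\in\{1,-1\}$ is the sign of the permutation $\begin{pmatrix}1&2&\cdots&2m-1&2m\\ u_1&v_1&\cdots&u_m&v_m\end{pmatrix}$, where the edges of $M$ are $u_iv_i$, oriented in $D$ from $u_i$ to $v_i$ (independent of the order in which the edges are listed). For a positive integer $k$, a $k$-orientation of $G$ is a vector $\mathbf{D}=(D_1,\dots,D_k)$ of orientations of $G$; for a perfect matching $M$, $\mathbf{sign}_{\mathbf{D}}(M) := (\operatorname{sign}_{D_1}(M),\dots,\operatorname{sign}_{D_k}(M))$, and the signature matrix $\mathbf{sign}_{\mathbf{D}}$ has these vectors as rows, one row for each perfect matching $M$ of $G$. $\mathbf{D}$ is pfaffian if $\mathbf{sign}_{\mathbf{D}}\,\mathbf{x}=\mathbf{1}$ has a solution $\mathbf{x}\in\mathbb{R}^k$. $G$ is $k$-pfaffian if it admits a pfaffian $k$-orientation (independent of the enumeration of the vertices). The pfaffian number $\operatorname{pf}(G)$ is the smallest positive integer $k$ such that $G$ is $k$-pfaffian (it always exists). The graph $\mathbb{V}_n$: let $H$ be the graph obtained from $K_{3,3}$ by choosing two non-adjacent edges and replacing each of them by a path of length three with the same ends (whose two interior vertices are new and have degree two in $H$). Take $n$ pairwise disjoint copies $H_1,\dots,H_n$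 of $H$. Denote by $u_i,v_i$ the two interior vertices of one of these paths of length three in $H_i$, and by $p_i,q_i$ the two interior vertices of the other one. $\mathbb{V}_n$ is formed by $H_1,\dots,H_n$ together with the edges $u_ip_{i+1}$ and $v_iq_{i+1}$ for $1\le i\le n-1$, and the edges $u_np_1$ and $v_nq_1$. The labels are chosen consistently so that $\mathbb{V}_n$ is bipartite (it is then bipartite, cubic and matching covered), e.g. so that in the bipartition of each $H_i$ the vertices $u_i$ and $p_i$ lie in different colour classes. *)

theory Defs
  imports Complex_Main "HOL-Combinatorics.Permutations"
begin

type_synonym 'a graph = "'a set \<times> 'a set set"

abbreviation verts :: "'a graph \<Rightarrow> 'a set" where "verts \<equiv> fst"
abbreviation edges :: "'a graph \<Rightarrow> 'a set set" where "edges \<equiv> snd"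

definition simple_graph :: "'a graph \<Rightarrow> bool" where
  "simple_graph G \<longleftrightarrow> finite (verts G) \<and> (\<forall>e\<in>edges G. e \<subseteq> verts G \<and> card e = 2)"

definition perfect_matching :: "'a graph \<Rightarrow> 'a set set \<Rightarrow> bool" where
  "perfect_matching G M \<longleftrightarrow> M \<subseteq> edges G \<and> (\<forall>v\<in>verts G. \<exists>!e. e \<in> M \<and> v \<in> e)"

definition orientation :: "'a graph \<Rightarrow> ('a \<times> 'a) set \<Rightarrow> bool" where
  "orientation G D \<longleftrightarrow>
     (\<forall>(u, v)\<in>D. {u, v} \<in> edges G) \<and>
     (\<forall>u v. {u, v} \<in> edges G \<longrightarrow> ((u, v) \<in> D \<longleftrightarrow> (v, u) \<notin> D))"

text \<open>An enumeration numbers the vertices, so vertex \<open>v\<close> is vertex number \<open>enum v\<close>.\<close>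

definition enumeration :: "'a graph \<Rightarrow> ('a \<Rightarrow> nat) \<Rightarrow> bool" where
  "enumeration G enum \<longleftrightarrow> bij_betw enum (verts G) {1..card (verts G)}"

text \<open>The permutation with bottom row \<open>xs\<close> in two-line notation (identity beyond \<open>length xs\<close>).\<close>

definition two_line :: "nat list \<Rightarrow> nat \<Rightarrow> nat" where
  "two_line xs j = (if j \<in> {1..length xs} then xs ! (j - 1) else j)"

definition matching_arcs :: "('a \<times> 'a) set \<Rightarrow> 'a set set \<Rightarrow> ('a \<times> 'a) set" where
  "matching_arcs D M = {(u, v) \<in> D. {u, v} \<in> M}"

text \<open>The sign does not depend on the order in which the edges are listed, so any listing
  may be chosen.\<close>

definition matching_sign :: "('a \<Rightarrow> nat) \<Rightarrow> ('a \<times> 'a) set \<Rightarrow> 'a set set \<Rightarrow> int" where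
  "matching_sign enum D M =
     (let es = (SOME es. distinct es \<and> set es = matching_arcs D M)
      in sign (two_line (concat (map (\<lambda>(u, v). [enum u, enum v]) es))))"

text \<open>Vectors with \<open>k\<close> entries are functions on \<open>nat\<close>, of which only the values on
  \<open>{1..k}\<close> are used.\<close>

definition k_orientation :: "'a graph \<Rightarrow> nat \<Rightarrow> (nat \<Rightarrow> ('a \<times> 'a) set) \<Rightarrow> bool" where
  "k_orientation G k D \<longleftrightarrow> (\<forall>i\<in>{1..k}. orientation G (D i))"

definition signature_matrix ::
    "('a \<Rightarrow> nat) \<Rightarrow> (nat \<Rightarrow> ('a \<times> 'a) set) \<Rightarrow> 'a set set \<Rightarrow> nat \<Rightarrow> real" where
  "signature_matrix enum D M i = of_int (matching_sign enum (D i) M)"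

definition pfaffian ::
    "'a graph \<Rightarrow> ('a \<Rightarrow> nat) \<Rightarrow> nat \<Rightarrow> (nat \<Rightarrow> ('a \<times> 'a) set) \<Rightarrow> bool" where
  "pfaffian G enum k D \<longleftrightarrow>
     (\<exists>x :: nat \<Rightarrow> real. \<forall>M. perfect_matching G M \<longrightarrow>
        (\<Sum>i = 1..k. signature_matrix enum D M i * x i) = 1)"

text \<open>Renumbering the vertices multiplies the whole signature matrix by the same sign, so the
  choice of the enumeration is immaterial.\<close>

definition k_pfaffian :: "nat \<Rightarrow> 'a graph \<Rightarrow> bool" where
  "k_pfaffian k G \<longleftrightarrow>
     (\<exists>enum D. enumeration G enum \<and> k_orientation G k D \<and> pfaffian G enum k D)"

definition pf :: "'a graph \<Rightarrow> nat" where
  "pf G = (LEAST k. 0 < k \<and> k_pfaffian k G)"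

text \<open>The vertices of \<open>K\<^sub>3\<^sub>,\<^sub>3\<close> (colour classes \<open>A\<close> and \<open>B\<close>) and the four interior vertices of
  the two paths that replace the edges \<open>A1 B1\<close> and \<open>A2 B2\<close>.\<close>

datatype H_vertex = A1 | A2 | A3 | B1 | B2 | B3 | Hu | Hv | Hp | Hq

definition K33_edges :: "H_vertex set set" where
  "K33_edges = {{a, b} | a b. a \<in> {A1, A2, A3} \<and> b \<in> {B1, B2, B3}}"

text \<open>The paths are \<open>A1 - u - v - B1\<close> and \<open>A2 - q - p - B2\<close>; thus \<open>u\<close> and \<open>q\<close> lie in the colour
  class of the \<open>B\<close>s, while \<open>v\<close> and \<open>p\<close> lie in that of the \<open>A\<close>s.\<close>

definition H_edges :: "H_vertex set set" where
  "H_edges = (K33_edges - {{A1, B1}, {A2, B2}})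
     \<union> {{A1, Hu}, {Hu, Hv}, {Hv, B1}}
     \<union> {{A2, Hq}, {Hq, Hp}, {Hp, B2}}"

definition vyalyi :: "nat \<Rightarrow> (nat \<times> H_vertex) graph" where
  "vyalyi n =
     ({1..n} \<times> UNIV,
      {{(i, x), (i, y)} | i x y. i \<in> {1..n} \<and> {x, y} \<in> H_edges}
      \<union> {{(i, Hu), (i + 1, Hp)} | i. 1 \<le> i \<and> i < n}
      \<union> {{(i, Hv), (i + 1, Hq)} | i. 1 \<le> i \<and> i < n}
      \<union> {{(n, Hu), (1, Hp)}, {(n, Hv), (1, Hq)}})"

lemma UNIV_H_vertex: "UNIV = {A1, A2, A3, B1, B2, B3, Hu, Hv, Hp, Hq}"
  by (auto intro: H_vertex.exhaust)

lemma H_edges_bipartite: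
  assumes "{x, y} \<in> H_edges"
  shows "x \<in> {A1, A2, A3, Hv, Hp} \<longleftrightarrow> y \<in> {B1, B2, B3, Hu, Hq}"
proof -
  have K: "(x \<in> {A1, A2, A3} \<and> y \<in> {B1, B2, B3}) \<or> (y \<in> {A1, A2, A3} \<and> x \<in> {B1, B2, B3})"
    if "{x, y} \<in> K33_edges"
    using that unfolding K33_edges_def by (auto simp only: mem_Collect_eq doubleton_eq_iff)
  show ?thesis
    using assms K unfolding H_edges_def Un_iff Diff_iff insert_iff empty_iff doubleton_eq_iff
    by (elim disjE conjE) auto
qed

lemma simple_graph_vyalyi:
  assumes "n \<ge> 1"
  shows "simple_graph (vyalyi n)"
proof -
  have "x \<noteq> y" if "{x, y} \<in> H_edges" for x y
    using H_edges_bipartite[OF that] by (cases x) auto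
  moreover have "finite (UNIV :: H_vertex set)"
    by (simp add: UNIV_H_vertex)
  ultimately show ?thesis
    using assms by (auto simp: simple_graph_def vyalyi_def card_insert_if)
qed

end

theory Submission imports Defs begin

text \<open>Only the perfect matchings of \<open>V\<^sub>n\<close> that use no edge between different copies of \<open>H\<close> are needed. Each
  copy has six perfect matchings, those of \<open>K\<^sub>3\<^sub>,\<^sub>3\<close>, so these matchings are indexed by functions \<open>\<rho>\<close> from
  blocks to local choices. For an orientation \<open>D\<close>, the sign of the matching of \<open>\<rho>\<close> is, up to a factor
  independent of \<open>D\<close> and \<open>\<rho>\<close>, a product over the blocks \<open>j\<close> of local signs \<open>b\<^sub>D j (\<rho> j)\<close>
  (\<open>matching_sign_V_matching\<close>), and the product of \<open>b\<^sub>D j r\<close> over the six local choices \<open>r\<close> is \<open>-1\<close>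
  whatever \<open>D\<close> is (\<open>prod_block_sign\<close>): every edge of \<open>H\<close> occurs in an even number of the six matchings,
  and the permutations of an odd number of them are odd relative to a fixed one. This is the
  obstruction that makes \<open>K\<^sub>3\<^sub>,\<^sub>3\<close> non-pfaffian.

  What remains is a statement about sign matrices (\<open>blocks_bound\<close>): if a weighted sum of columns that
  are products of local signs, with product \<open>-1\<close> in each block, is \<open>1\<close> in every row \<open>\<rho>\<close>, then there are at least \<open>3n + 1\<close> columns. It is proved by
  induction on the number of blocks. Compare two local choices in the last block. The columns on which
  they differ contribute \<open>0\<close>, so removing them leaves a system for the other blocks; if for some pair
  there are at least three of them, the induction hypothesis finishes the proof. Otherwise any two
  local choices differ in at most two columns, and such a pair of columns is proportional on the
  other blocks. Group the columns into classes of columns proportional on the other blocks. On each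
  class the sum is then constant in the last block. Where this constant is nonzero, the
  one-block argument (\<open>constant_combination_card_ge_4\<close>) gives at least four columns, and by the
  induction hypothesis at least \<open>3(n - 1) + 1\<close> classes have a nonzero constant; finally
  \<open>4(3n - 2) \<ge> 3n + 1\<close>.

  As \<open>pf\<close> is a least element, some pfaffian orientation vector must also be exhibited. The vector of
  all orientations works (\<open>ex_k_pfaffian\<close>): the sign vectors of different matchings, as functions of the
  orientation, are orthogonal.\<close>

section \<open>Weighted sums of products of signs\<close>

text \<open>Two signings \<open>b\<close>, \<open>b'\<close> of the indices that give the same weighted sum: the indices at which
  they differ contribute \<open>0\<close>, because each of them contributes opposite amounts to the two sums.\<close>

lemma disagreement_sum:
  fixes y :: "'i \<Rightarrow> real"
  assumes "finite I" and "\<And>i. i \<in> I \<Longrightarrow> b i \<in> {-1, 1}" and "\<And>i. i \<in> I \<Longrightarrow> b' i \<in> {-1, 1}"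
    and "(\<Sum>i\<in>I. y i * b i) = (\<Sum>i\<in>I. y i * b' i)"
  shows "(\<Sum>i\<in>{i \<in> I. b i \<noteq> b' i}. y i * b i) = 0"
proof -
  have "0 = (\<Sum>i\<in>I. y i * b i - y i * b' i)"
    using assms(4) by (simp add: sum_subtractf)
  also have "\<dots> = (\<Sum>i\<in>I. if b i \<noteq> b' i then 2 * (y i * b i) else 0)"
    using assms(2,3) by (intro sum.cong) fastforce+
  also have "\<dots> = 2 * (\<Sum>i\<in>{i \<in> I. b i \<noteq> b' i}. y i * b i)"
    using assms(1) by (simp add: sum.inter_filter sum_distrib_left if_distrib[of "\<lambda>t. 2 * t"]
        cong: if_cong)
  finally show ?thesis by simp
qed

lemma disagreement_card_ne_1:
  fixes y :: "'i \<Rightarrow> real"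
  assumes "finite I" and "\<And>i. i \<in> I \<Longrightarrow> b i \<in> {-1, 1}" and "\<And>i. i \<in> I \<Longrightarrow> b' i \<in> {-1, 1}"
    and "(\<Sum>i\<in>I. y i * b i) = (\<Sum>i\<in>I. y i * b' i)" and "\<And>i. i \<in> I \<Longrightarrow> y i \<noteq> 0"
  shows "card {i \<in> I. b i \<noteq> b' i} \<noteq> 1"
proof
  assume "card {i \<in> I. b i \<noteq> b' i} = 1"
  then obtain i where i: "{i \<in> I. b i \<noteq> b' i} = {i}"
    by (auto simp: card_1_singleton_iff)
  then have "i \<in> I" by auto
  moreover have "y i * b i = 0"
    using disagreement_sum[OF assms(1-4)] unfolding i by simp
  ultimately show False using assms(2)[of i] assms(5)[of i] by auto
qed

text \<open>The case of one block. Any two rows \<open>r\<close>, \<open>r'\<close> differ in a number of columns that is neither \<open>1\<close>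
  (the weights are nonzero) nor all of them (the sum would change its sign). So with at most three
  columns they differ in \<open>0\<close> or \<open>2\<close> columns. For an odd number of columns the product of the
  entries is then the same in all rows, against the product of all entries being \<open>-1\<close>; for two
  columns all rows are equal, against the product down a column being \<open>-1\<close>.\<close>

lemma constant_combination_card_ge_4:
  fixes x :: "'i \<Rightarrow> real" and b :: "'i \<Rightarrow> 'r \<Rightarrow> real"
  assumes C: "finite C" and R: "finite R" "even (card R)"
    and b: "\<And>i r. i \<in> C \<Longrightarrow> r \<in> R \<Longrightarrow> b i r \<in> {-1, 1}"
    and odd: "\<And>i. i \<in> C \<Longrightarrow> (\<Prod>r\<in>R. b i r) = -1"
    and x: "\<And>i. i \<in> C \<Longrightarrow> x i \<noteq> 0"
    and g: "\<And>r. r \<in> R \<Longrightarrow> (\<Sum>i\<in>C. x i * b i r) = g" "g \<noteq> 0"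
    and r0: "r0 \<in> R"
  shows "card C \<ge> 4"
proof (rule ccontr)
  assume "\<not> card C \<ge> 4"
  then have C3: "card C \<le> 3" by simp
  define Dis where "Dis r r' = {i \<in> C. b i r \<noteq> b i r'}" for r r'
  have C_ne: "C \<noteq> {}" using g r0 by auto
  have Dis: "card (Dis r r') \<noteq> 1 \<and> card (Dis r r') < card C" if "r \<in> R" "r' \<in> R" for r r'
  proof -
    have eq: "(\<Sum>i\<in>C. x i * b i r) = (\<Sum>i\<in>C. x i * b i r')" using g(1) that by simp
    have "card (Dis r r') \<noteq> 1"
      unfolding Dis_def using disagreement_card_ne_1[OF C _ _ eq x] b that by auto
    moreover have "Dis r r' \<noteq> C"
      using disagreement_sum[OF C _ _ eq] b that g unfolding Dis_def[symmetric] by auto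
    moreover have "Dis r r' \<subseteq> C" unfolding Dis_def by auto
    ultimately show ?thesis using C by (simp add: psubset_card_mono psubsetI)
  qed
  show False
  proof (cases "odd (card C)")
    case True
    have const: "(\<Prod>i\<in>C. b i r) = (\<Prod>i\<in>C. b i r0)" if r: "r \<in> R" for r
    proof -
      have "(\<Prod>i\<in>C. b i r) = (\<Prod>i\<in>C. b i r0 * (if b i r \<noteq> b i r0 then -1 else 1))"
        using b[OF _ r] b[OF _ r0] by (intro prod.cong refl) force
      also have "\<dots> = (\<Prod>i\<in>C. b i r0) * (-1) ^ card (Dis r r0)"
        using C by (simp add: prod.distrib Dis_def flip: prod.inter_filter)
      also have "(-1 :: real) ^ card (Dis r r0) = 1"
      proof -
        have "card (Dis r r0) = 0 \<or> card (Dis r r0) = 2"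
          using Dis[OF r r0] C3 by linarith
        then show ?thesis by auto
      qed
      finally show ?thesis by simp
    qed
    have "(-1 :: real) ^ card C = (\<Prod>i\<in>C. \<Prod>r\<in>R. b i r)"
      using odd by simp
    also have "\<dots> = (\<Prod>r\<in>R. \<Prod>i\<in>C. b i r)" by (rule prod.swap)
    also have "\<dots> = (\<Prod>i\<in>C. b i r0) ^ card R" using const by simp
    also have "\<dots> \<ge> 0" using R by (simp add: zero_le_even_power)
    finally show False using True by simp
  next
    case False
    then have "card C \<le> 2" using C3 by presburger
    obtain i where i: "i \<in> C" using C_ne by auto
    have "b i r = b i r0" if "r \<in> R" for r
    proof -
      have "card (Dis r r0) = 0" using Dis[OF that r0] \<open>card C \<le> 2\<close> by linarith
      then have "Dis r r0 = {}" using C by (simp add: Dis_def)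
      then show ?thesis using i by (auto simp: Dis_def)
    qed
    then have "(\<Prod>r\<in>R. b i r) = b i r0 ^ card R" by simp
    also have "\<dots> \<ge> 0" using R by (simp add: zero_le_even_power)
    finally show False using odd[OF i] by simp
  qed
qed

text \<open>The signature matrix is abstracted to columns \<open>i \<in> I\<close>; column \<open>i\<close> is a product of signs
  \<open>b i j r\<close>, one for each block \<open>j < n\<close>, where \<open>r \<in> R\<close> is the local choice made in that block. A row is
  a function \<open>\<rho>\<close> picking one local choice for each block; its values outside \<open>{..<n}\<close> are immaterial,
  but requiring all of them to lie in \<open>R\<close> makes constant functions available.\<close>

lemma blocks_bound:
  fixes x :: "'i \<Rightarrow> real" and b :: "'i \<Rightarrow> nat \<Rightarrow> 'r \<Rightarrow> real"
  assumes "finite I" and R: "finite R" "even (card R)" and "R \<noteq> {}"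
    and "\<And>i j r. i \<in> I \<Longrightarrow> j < n \<Longrightarrow> r \<in> R \<Longrightarrow> b i j r \<in> {-1, 1}"
    and "\<And>i j. i \<in> I \<Longrightarrow> j < n \<Longrightarrow> (\<Prod>r\<in>R. b i j r) = -1"
    and "\<And>\<rho>. range \<rho> \<subseteq> R \<Longrightarrow> (\<Sum>i\<in>I. x i * (\<Prod>j<n. b i j (\<rho> j))) = 1"
  shows "card I \<ge> 3 * n + 1"
proof -
  obtain r0 where r0: "r0 \<in> R" using \<open>R \<noteq> {}\<close> by auto
  show ?thesis
    using assms(1,5-)
  proof (induction n arbitrary: I x)
    case 0
    have "range (\<lambda>_. r0) \<subseteq> R" using r0 by auto
    from "0.prems"(4)[OF this] have "I \<noteq> {}" by auto
    then show ?case using "0.prems"(1) by (simp add: Suc_le_eq card_gt_0_iff)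
  next
    case (Suc n I0 x)
    define I where "I = {i \<in> I0. x i \<noteq> 0}"
    have fin: "finite I" and sub: "I \<subseteq> I0" and x: "\<And>i. i \<in> I \<Longrightarrow> x i \<noteq> 0"
      using Suc.prems(1) by (auto simp: I_def)
    have b: "b i j r \<in> {-1, 1}" if "i \<in> I" "j < Suc n" "r \<in> R" for i j r
      using Suc.prems(2) that sub by blast
    have odd: "(\<Prod>r\<in>R. b i j r) = -1" if "i \<in> I" "j < Suc n" for i j
      using Suc.prems(3) that sub by blast
    \<comment> \<open>The sign that column \<open>i\<close> gives to the first \<open>n\<close> blocks.\<close>
    define P where "P i \<rho> = (\<Prod>j<n. b i j (\<rho> j))" for i and \<rho> :: "nat \<Rightarrow> 'r"
    have P: "P i \<rho> \<in> {-1, 1}" if "i \<in> I" "range \<rho> \<subseteq> R" for i \<rho>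
    proof -
      have "\<bar>P i \<rho>\<bar> = (\<Prod>j<n. \<bar>b i j (\<rho> j)\<bar>)" unfolding P_def by (rule abs_prod)
      also have "\<dots> = (\<Prod>j<n. 1)"
      proof (intro prod.cong refl)
        fix j assume "j \<in> {..<n}"
        moreover have "\<rho> j \<in> R" using that(2) by auto
        ultimately show "\<bar>b i j (\<rho> j)\<bar> = 1" using b[of i j "\<rho> j"] that(1) by auto
      qed
      finally show ?thesis by auto
    qed
    have eq: "(\<Sum>i\<in>I. x i * P i \<rho> * b i n r) = 1" if "range \<rho> \<subseteq> R" "r \<in> R" for \<rho> r
    proof -
      have "range (\<rho>(n := r)) \<subseteq> R" using that by auto
      from Suc.prems(4)[OF this]
      have "1 = (\<Sum>i\<in>I0. x i * (\<Prod>j<Suc n. b i j ((\<rho>(n := r)) j)))" by simp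
      also have "\<dots> = (\<Sum>i\<in>I0. x i * P i \<rho> * b i n r)"
        by (simp add: P_def mult.assoc)
      also have "\<dots> = (\<Sum>i\<in>I. x i * P i \<rho> * b i n r)"
        unfolding I_def using Suc.prems(1) by (intro sum.mono_neutral_right) auto
      finally show ?thesis by simp
    qed
    \<comment> \<open>The columns in which two local choices in the last block differ.\<close>
    define Dis where "Dis r r' = {i \<in> I. b i n r \<noteq> b i n r'}" for r r'
    have Dis_sum: "(\<Sum>i\<in>Dis r r'. x i * P i \<rho> * b i n r) = 0"
      if "range \<rho> \<subseteq> R" "r \<in> R" "r' \<in> R" for \<rho> r r'
      unfolding Dis_def by (rule disagreement_sum[OF fin]) (use b eq that in auto)
    have IH: "card J \<ge> 3 * n + 1"
      if "J \<subseteq> I" "\<And>\<rho>. range \<rho> \<subseteq> R \<Longrightarrow> (\<Sum>i\<in>J. z i * P i \<rho>) = 1" for J and z :: "'i \<Rightarrow> real"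
    proof (rule Suc.IH)
      show "finite J" using that(1) fin by (rule finite_subset)
      show "b i j r \<in> {-1, 1}" if "i \<in> J" "j < n" "r \<in> R" for i j r
        using b[of i j r] that \<open>J \<subseteq> I\<close> by auto
      show "(\<Prod>r\<in>R. b i j r) = -1" if "i \<in> J" "j < n" for i j
        using odd[of i j] that \<open>J \<subseteq> I\<close> by auto
    qed (use that(2) P_def in auto)
    have "card I \<ge> 3 * Suc n + 1"
    proof (cases "\<exists>r\<in>R. \<exists>r'\<in>R. card (Dis r r') \<ge> 3")
      case True
      \<comment> \<open>Deleting the columns in which \<open>r\<close> and \<open>r'\<close> differ leaves a system for \<open>n\<close> blocks.\<close>
      then obtain r r' where r: "r \<in> R" "r' \<in> R" "card (Dis r r') \<ge> 3" by auto
      have "card (I - Dis r r') \<ge> 3 * n + 1"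
      proof (rule IH)
        fix \<rho> :: "nat \<Rightarrow> 'r" assume \<rho>: "range \<rho> \<subseteq> R"
        have "(\<Sum>i\<in>I - Dis r r'. x i * P i \<rho> * b i n r) = 1 - 0"
          unfolding eq[OF \<rho> r(1), symmetric] Dis_sum[OF \<rho> r(1,2), symmetric]
          using fin by (intro sum_diff) (auto simp: Dis_def)
        then show "(\<Sum>i\<in>I - Dis r r'. x i * b i n r * P i \<rho>) = 1"
          by (simp add: mult_ac)
      qed auto
      moreover have "card (I - Dis r r') = card I - card (Dis r r')" "card (Dis r r') \<le> card I"
        using fin by (auto simp: Dis_def intro!: card_Diff_subset card_mono)
      ultimately show ?thesis using r(3) by simp
    next
      case False
      then have Dis2: "card (Dis r r') \<le> 2" if "r \<in> R" "r' \<in> R" for r r'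
        using that by (metis not_less_eq_eq numeral_2_eq_2 numeral_3_eq_3)
      let ?\<rho>0 = "\<lambda>_::nat. r0"
      have \<rho>0: "range ?\<rho>0 \<subseteq> R" using r0 by auto
      \<comment> \<open>\<open>A i\<close> is \<open>P i\<close> normalised to the value \<open>1\<close> at a reference row, so that columns whose
        restrictions to the first \<open>n\<close> blocks agree up to a sign have the same \<open>A i\<close>; the value off
        the rows is a dummy that makes \<open>A i = A j\<close> an equation of functions.\<close>
      define A where "A i = (\<lambda>\<rho>. if range \<rho> \<subseteq> R then P i \<rho> * P i ?\<rho>0 else 0)" for i
      define y where "y i = x i * P i ?\<rho>0" for i
      have PP: "P i \<rho> * P i \<rho> = 1" if "i \<in> I" "range \<rho> \<subseteq> R" for i and \<rho> :: "nat \<Rightarrow> 'r"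
        using P[OF that] by auto
      have xP: "x i * P i \<rho> = y i * A i \<rho>" if "i \<in> I" "range \<rho> \<subseteq> R" for i \<rho>
        using PP[OF that(1) \<rho>0] that by (simp add: y_def A_def)
      have A0: "A i ?\<rho>0 = 1" if "i \<in> I" for i
        using PP[OF that \<rho>0] \<rho>0 by (simp add: A_def)
      have y: "y i \<noteq> 0" if "i \<in> I" for i
        using x[OF that] P[OF that \<rho>0] by (auto simp: y_def)
      \<comment> \<open>At most two columns lie in \<open>Dis r r'\<close>, and their contributions cancel for every row of the
        first \<open>n\<close> blocks, so these two columns are proportional there.\<close>
      have same: "A i = A j" if "r \<in> R" "r' \<in> R" "i \<in> Dis r r'" "j \<in> Dis r r'" for r r' i j
      proof (cases "i = j")
        case ne: False
        have ij: "i \<in> I" "j \<in> I" using that(3,4) by (auto simp: Dis_def)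
        have "finite (Dis r r')" using fin by (simp add: Dis_def)
        then have "Dis r r' = {i, j}"
          using Dis2[OF that(1,2)] that(3,4) ne
          by (metis card_2_iff card_seteq empty_subsetI insert_subset)
        then have zero: "y i * A i \<rho> * b i n r + y j * A j \<rho> * b j n r = 0" if "range \<rho> \<subseteq> R" for \<rho> :: "nat \<Rightarrow> 'r"
          using Dis_sum[OF that \<open>r \<in> R\<close> \<open>r' \<in> R\<close>] ne ij that by (simp add: xP)
        have neg: "y i * b i n r = - (y j * b j n r)" using zero[OF \<rho>0] A0 ij by simp
        have nz: "y i * b i n r \<noteq> 0"
          using y[OF ij(1)] b[OF ij(1), of n r] \<open>r \<in> R\<close> by auto
        have "A i \<rho> = A j \<rho>" if "range \<rho> \<subseteq> R" for \<rho> :: "nat \<Rightarrow> 'r"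
        proof -
          have "(y i * b i n r) * A i \<rho> = - (y j * b j n r) * A j \<rho>"
            using zero[OF that] by (simp add: mult_ac)
          then show ?thesis using neg nz by (metis mult_left_cancel)
        qed
        then show ?thesis by (auto simp: A_def)
      qed auto
      define Cl where "Cl \<alpha> = {i \<in> I. A i = \<alpha>}" for \<alpha>
      define g where "g \<alpha> = (\<Sum>i\<in>Cl \<alpha>. y i * b i n r0)" for \<alpha>
      \<comment> \<open>Hence \<open>Dis r r'\<close> lies inside one class, so the partial sum over a class is the same for all
        local choices in the last block.\<close>
      have g: "(\<Sum>i\<in>Cl \<alpha>. y i * b i n r) = g \<alpha>" if r: "r \<in> R" for \<alpha> r
      proof -
        have finC: "finite (Cl \<alpha>)" using fin by (simp add: Cl_def)
        have "(\<Sum>i\<in>Cl \<alpha>. y i * b i n r) - g \<alpha> = (\<Sum>i\<in>Cl \<alpha>. y i * b i n r - y i * b i n r0)"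
          by (simp add: g_def sum_subtractf)
        also have "\<dots> = (\<Sum>i\<in>Cl \<alpha> \<inter> Dis r r0. y i * b i n r - y i * b i n r0)"
          using finC by (intro sum.mono_neutral_right) (auto simp: Cl_def Dis_def)
        also have "\<dots> = (\<Sum>i\<in>Cl \<alpha> \<inter> Dis r r0. 2 * (y i * b i n r))"
        proof (intro sum.cong refl)
          fix i assume "i \<in> Cl \<alpha> \<inter> Dis r r0"
          then show "y i * b i n r - y i * b i n r0 = 2 * (y i * b i n r)"
            using b[of i n r] b[of i n r0] r r0 by (auto simp: Cl_def Dis_def)
        qed
        also have "\<dots> = 0"
        proof (cases "Cl \<alpha> \<inter> Dis r r0 = {}")
          case False
          then obtain i where i: "i \<in> I" "A i = \<alpha>" "i \<in> Dis r r0" by (auto simp: Cl_def)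
          have "A j = \<alpha>" if "j \<in> Dis r r0" for j
            using same[OF r r0 that i(3)] i(2) by simp
          then have "Cl \<alpha> \<inter> Dis r r0 = Dis r r0" by (auto simp: Cl_def Dis_def)
          then show ?thesis using Dis_sum[OF \<rho>0 r r0] by (simp add: y_def flip: sum_distrib_left)
        qed auto
        finally show ?thesis by simp
      qed
      define K where "K = {\<alpha> \<in> A ` I. g \<alpha> \<noteq> 0}"
      define w where "w = inv_into I A"
      have w: "w \<alpha> \<in> I" "A (w \<alpha>) = \<alpha>" if "\<alpha> \<in> K" for \<alpha>
        using that by (auto simp: K_def w_def inv_into_into f_inv_into_f)
      have inj: "inj_on w K" using w by (metis inj_onI)
      have finK: "finite K" using fin by (simp add: K_def)
      \<comment> \<open>One representative of each class with a nonzero sum gives a system for \<open>n\<close> blocks.\<close>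
      have "card (w ` K) \<ge> 3 * n + 1"
      proof (rule IH)
        show "w ` K \<subseteq> I" using w by auto
        fix \<rho> :: "nat \<Rightarrow> 'r" assume \<rho>: "range \<rho> \<subseteq> R"
        have "1 = (\<Sum>i\<in>I. y i * A i \<rho> * b i n r0)"
          using eq[OF \<rho> r0] \<rho> by (simp add: xP)
        also have "\<dots> = (\<Sum>\<alpha>\<in>A ` I. \<Sum>i\<in>Cl \<alpha>. y i * A i \<rho> * b i n r0)"
          unfolding Cl_def by (rule sum.image_gen[OF fin])
        also have "\<dots> = (\<Sum>\<alpha>\<in>A ` I. g \<alpha> * \<alpha> \<rho>)"
          by (intro sum.cong refl) (auto simp: g_def Cl_def sum_distrib_left sum_distrib_right mult_ac)
        also have "\<dots> = (\<Sum>\<alpha>\<in>K. g \<alpha> * \<alpha> \<rho>)"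
          using fin unfolding K_def by (intro sum.mono_neutral_right) auto
        also have "\<dots> = (\<Sum>\<alpha>\<in>K. g (A (w \<alpha>)) * P (w \<alpha>) ?\<rho>0 * P (w \<alpha>) \<rho>)"
        proof (intro sum.cong refl)
          fix \<alpha> assume "\<alpha> \<in> K"
          then have "\<alpha> \<rho> = A (w \<alpha>) \<rho>" using w by simp
          then show "g \<alpha> * \<alpha> \<rho> = g (A (w \<alpha>)) * P (w \<alpha>) ?\<rho>0 * P (w \<alpha>) \<rho>"
            using w \<open>\<alpha> \<in> K\<close> \<rho> by (simp add: A_def)
        qed
        also have "\<dots> = (\<Sum>i\<in>w ` K. g (A i) * P i ?\<rho>0 * P i \<rho>)"
          using inj by (simp add: sum.reindex)
        finally show "(\<Sum>i\<in>w ` K. g (A i) * P i ?\<rho>0 * P i \<rho>) = 1" by simp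
      qed
      then have cardK: "card K \<ge> 3 * n + 1" using inj by (simp add: card_image)
      have "card (Cl \<alpha>) \<ge> 4" if "\<alpha> \<in> K" for \<alpha>
      proof (rule constant_combination_card_ge_4[where R = R and b = "\<lambda>i. b i n" and x = y and g = "g \<alpha>"])
        show "g \<alpha> \<noteq> 0" using that by (simp add: K_def)
      qed (use fin R b odd y g r0 in \<open>auto simp: Cl_def\<close>)
      then have "4 * card K \<le> (\<Sum>\<alpha>\<in>K. card (Cl \<alpha>))"
        using sum_bounded_below[of K 4 "\<lambda>\<alpha>. card (Cl \<alpha>)"] by simp
      also have "\<dots> = card (\<Union>\<alpha>\<in>K. Cl \<alpha>)"
        using fin finK by (intro card_UN_disjoint[symmetric]) (auto simp: Cl_def)
      also have "\<dots> \<le> card I"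
        using fin by (intro card_mono) (auto simp: Cl_def)
      finally show ?thesis using cardK by simp
    qed
    also have "card I \<le> card I0" using Suc.prems(1) sub by (rule card_mono)
    finally show ?case .
  qed
qed

section \<open>Signs of matchings as signs of vertex lists\<close>

text \<open>The arcs \<open>u\<^sub>1v\<^sub>1, u\<^sub>2v\<^sub>2, \<dots>\<close> written out as the list of vertices \<open>u\<^sub>1, v\<^sub>1, u\<^sub>2, v\<^sub>2, \<dots>\<close>.\<close>

definition flat :: "('a \<times> 'a) list \<Rightarrow> 'a list" where
  "flat es = concat (map (\<lambda>(u, v). [u, v]) es)"

lemma flat_simps [simp]:
  "flat [] = []" "flat ((u, v) # es) = u # v # flat es" "flat (es @ es') = flat es @ flat es'"
  by (simp_all add: flat_def)

text \<open>The sign of the two-line permutation whose bottom row is a list of vertices.\<close>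

definition list_sign :: "('a \<Rightarrow> nat) \<Rightarrow> 'a list \<Rightarrow> int" where
  "list_sign enum vs = sign (two_line (map enum vs))"

text \<open>A list that runs through each element of \<open>V\<close> exactly once; the sign of \<open>list_sign\<close> is meaningful
  for listings of the vertex set.\<close>

definition listing :: "'a set \<Rightarrow> 'a list \<Rightarrow> bool" where
  "listing V vs \<longleftrightarrow> distinct vs \<and> set vs = V"

lemma two_line_permutes:
  assumes "distinct xs" and "set xs = {1..length xs}"
  shows "two_line xs permutes {1..length xs}"
proof (rule bij_imp_permutes)
  show "bij_betw (two_line xs) {1..length xs} {1..length xs}"
  proof (rule bij_betw_imageI)
    show "inj_on (two_line xs) {1..length xs}"
      using assms(1) by (auto simp: inj_on_def two_line_def nth_eq_iff_index_eq)
    have Suc: "{1..length xs} = Suc ` {0..<length xs}" by auto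
    have "two_line xs ` {1..length xs} = (\<lambda>j. xs ! j) ` {0..<length xs}"
      unfolding Suc image_image by (intro image_cong) (auto simp: two_line_def)
    also have "\<dots> = set xs"
      by (auto simp: set_conv_nth)
    finally show "two_line xs ` {1..length xs} = {1..length xs}" using assms(2) by simp
  qed
qed (auto simp: two_line_def)

lemma list_sign_transpose:
  assumes enum: "bij_betw enum V {1..card V}" and vs: "listing V vs"
    and xy: "x \<in> V" "y \<in> V" "x \<noteq> y"
  shows "list_sign enum (map (transpose x y) vs) = - list_sign enum vs"
proof -
  let ?ys = "map enum vs" and ?t = "transpose (enum x) (enum y)"
  have inj: "inj_on enum V" using enum by (rule bij_betw_imp_inj_on)
  have dist: "distinct ?ys"
    using vs inj by (simp add: listing_def distinct_map)
  have len: "length ?ys = card V"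
    using vs by (auto simp: listing_def distinct_card)
  have set: "set ?ys = {1..length ?ys}"
    using vs enum unfolding len by (simp add: listing_def bij_betw_def)
  have p: "two_line ?ys permutes {1..length ?ys}"
    using dist set by (rule two_line_permutes)
  have "map enum (map (transpose x y) vs) = map ?t ?ys"
    using vs xy inj by (auto simp: listing_def transpose_def inj_on_def)
  moreover have "two_line (map ?t ?ys) = ?t \<circ> two_line ?ys"
  proof
    fix j
    have "enum x \<in> {1..length ?ys}" "enum y \<in> {1..length ?ys}"
      using xy enum unfolding len by (auto simp: bij_betw_def)
    then show "two_line (map ?t ?ys) j = (?t \<circ> two_line ?ys) j"
      by (auto simp: two_line_def transpose_def)
  qed
  moreover have "sign (?t \<circ> two_line ?ys) = sign ?t * sign (two_line ?ys)"
    using p by (intro sign_compose permutation_swap_id) (metis finite_atLeastAtMost permutation_permutes)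
  moreover have "sign ?t = -1"
    using xy inj by (auto simp: sign_swap_id inj_on_def)
  ultimately show ?thesis unfolding list_sign_def by (simp only:)
qed

lemma list_sign_swap:
  assumes enum: "bij_betw enum V {1..card V}" and vs: "listing V (us @ x # y # ws)"
  shows "list_sign enum (us @ y # x # ws) = - list_sign enum (us @ x # y # ws)"
proof -
  have "map (transpose x y) zs = zs" if "x \<notin> set zs" "y \<notin> set zs" for zs
    using that by (induction zs) (auto simp: transpose_def)
  then have "map (transpose x y) (us @ x # y # ws) = us @ y # x # ws"
    using vs by (auto simp: listing_def)
  then show ?thesis
    using list_sign_transpose[OF enum vs, of x y] vs by (auto simp: listing_def)
qed

lemma listing_mset: "listing V vs \<Longrightarrow> mset vs = mset ws \<Longrightarrow> listing V ws"
  unfolding listing_def by (metis mset_eq_imp_distinct_iff mset_eq_setD)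

lemma list_sign_swap_arcs:
  assumes enum: "bij_betw enum V {1..card V}" and vs: "listing V (flat (es @ a # b # fs))"
  shows "list_sign enum (flat (es @ b # a # fs)) = list_sign enum (flat (es @ a # b # fs))"
proof -
  obtain u v x y where ab: "a = (u, v)" "b = (x, y)" by fastforce
  let ?e = "flat es" and ?f = "flat fs"
  have l: "listing V (?e @ u # v # x # y # ?f)" using vs by (simp add: ab)
  have "list_sign enum (?e @ u # x # v # y # ?f) = - list_sign enum (?e @ u # v # x # y # ?f)"
    using list_sign_swap[OF enum, of "?e @ [u]" v x "y # ?f"] l by simp
  moreover have "list_sign enum (?e @ x # u # v # y # ?f) = - list_sign enum (?e @ u # x # v # y # ?f)"
    using list_sign_swap[OF enum, of "?e" u x "v # y # ?f"] listing_mset[OF l] by simp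
  moreover have "list_sign enum (?e @ x # u # y # v # ?f) = - list_sign enum (?e @ x # u # v # y # ?f)"
    using list_sign_swap[OF enum, of "?e @ [x, u]" v y ?f] listing_mset[OF l] by simp
  moreover have "list_sign enum (?e @ x # y # u # v # ?f) = - list_sign enum (?e @ x # u # y # v # ?f)"
    using list_sign_swap[OF enum, of "?e @ [x]" u y "v # ?f"] listing_mset[OF l] by simp
  ultimately show ?thesis by (simp add: ab)
qed

lemma mset_flat: "mset es = mset fs \<Longrightarrow> mset (flat es) = mset (flat fs)"
proof -
  have "mset (flat es) = (\<Sum>(u, v)\<in>#mset es. {#u, v#})" for es :: "('a \<times> 'a) list"
    by (induction es) auto
  then show "mset es = mset fs \<Longrightarrow> mset (flat es) = mset (flat fs)" for es fs :: "('a \<times> 'a) list"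
    by simp
qed

text \<open>The sign does not depend on the order of the arcs. The prefix \<open>pre\<close> is what the induction needs:
  the first arc of \<open>es\<close> is moved to the front of \<open>fs\<close> by exchanges of neighbouring arcs.\<close>

lemma list_sign_order:
  assumes enum: "bij_betw enum V {1..card V}"
    and "listing V (flat (pre @ es))" and "mset es = mset fs"
  shows "list_sign enum (flat (pre @ es)) = list_sign enum (flat (pre @ fs))"
  using assms(2,3)
proof (induction es arbitrary: pre fs)
  case (Cons a es)
  have "a \<in> set fs" using Cons.prems(2) by (metis list.set_intros(1) mset_eq_setD)
  then obtain gs hs where fs: "fs = gs @ a # hs" by (meson split_list)
  have front: "list_sign enum (flat (pre @ gs @ a # hs)) = list_sign enum (flat (pre @ a # gs @ hs))"
    if "listing V (flat (pre @ a # gs @ hs))" for pre gs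
    using that
  proof (induction gs arbitrary: pre)
    case (Cons g gs)
    have l: "listing V (flat (pre @ g # a # gs @ hs))"
      by (rule listing_mset[OF Cons.prems mset_flat]) simp
    have "list_sign enum (flat (pre @ (g # gs) @ a # hs)) = list_sign enum (flat (pre @ g # a # gs @ hs))"
      using Cons.IH[of "pre @ [g]"] l by simp
    also have "\<dots> = list_sign enum (flat (pre @ a # (g # gs) @ hs))"
      using list_sign_swap_arcs[OF enum, of pre a g "gs @ hs"] Cons.prems by simp
    finally show ?case .
  qed simp
  have "mset (pre @ a # es) = mset (pre @ a # gs @ hs)"
    using Cons.prems(2) by (simp add: fs)
  from front[OF listing_mset[OF Cons.prems(1) mset_flat[OF this]]]
  show ?case 
    using Cons.IH[of "pre @ [a]" "gs @ hs"] Cons.prems by (simp add: fs)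
qed simp

text \<open>\<open>1\<close> or \<open>-1\<close> according to whether the arc is directed as in \<open>D\<close> or against it.\<close>

definition arc_sign :: "('a \<times> 'a) set \<Rightarrow> 'a \<times> 'a \<Rightarrow> int" where
  "arc_sign D a = (if a \<in> D then 1 else -1)"

text \<open>The arc with the same ends that agrees with \<open>D\<close>.\<close>

definition orient :: "('a \<times> 'a) set \<Rightarrow> 'a \<times> 'a \<Rightarrow> 'a \<times> 'a" where
  "orient D a = (if a \<in> D then a else prod.swap a)"

text \<open>The undirected edge underlying an arc.\<close>

definition ends :: "'a \<times> 'a \<Rightarrow> 'a set" where
  "ends a = {fst a, snd a}"

lemma ends_swap [simp]: "ends (prod.swap a) = ends a"
  by (auto simp: ends_def)

lemma orientation_swap:
  assumes "orientation G D" and "ends a \<in> edges G"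
  shows "prod.swap a \<in> D \<longleftrightarrow> a \<notin> D"
proof -
  obtain u v where a: "a = (u, v)" by fastforce
  then have "{u, v} \<in> edges G" using assms(2) by (simp add: ends_def)
  then show ?thesis using assms(1) unfolding orientation_def a by auto
qed

lemma mset_flat_orient: "mset (flat (map (orient D) es)) = mset (flat es)"
  by (induction es) (auto simp: orient_def)

lemma set_flat: "set (flat es) = (\<Union>a\<in>set es. ends a)"
proof (induction es)
  case (Cons a es)
  then show ?case by (cases a) (auto simp: ends_def)
qed simp

lemma distinct_ends: "distinct (flat es) \<Longrightarrow> distinct (map ends es)"
proof (induction es)
  case (Cons a es)
  obtain u v where a: "a = (u, v)" by fastforce
  have "u \<notin> \<Union>(ends ` set es)" "distinct (flat es)"
    using Cons.prems unfolding a by (auto simp: set_flat)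
  then show ?case using Cons.IH by (auto simp: a ends_def)
qed simp

lemma list_sign_orient:
  assumes enum: "bij_betw enum V {1..card V}" and "listing V (flat (pre @ es))"
  shows "list_sign enum (flat (pre @ map (orient D) es))
    = prod_list (map (arc_sign D) es) * list_sign enum (flat (pre @ es))"
  using assms(2)
proof (induction es arbitrary: pre)
  case (Cons a es)
  obtain u v where a: "a = (u, v)" by fastforce
  have "listing V (flat ((pre @ [orient D a]) @ es))"
    by (rule listing_mset[OF Cons.prems]) (auto simp: orient_def a)
  from Cons.IH[OF this] have "list_sign enum (flat (pre @ map (orient D) (a # es)))
     = prod_list (map (arc_sign D) es) * list_sign enum (flat (pre @ orient D a # es))"
    by simp
  also have "list_sign enum (flat (pre @ orient D a # es))
      = arc_sign D a * list_sign enum (flat (pre @ a # es))"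
    using list_sign_swap[OF enum, of "flat pre" u v "flat es"] Cons.prems
    by (auto simp: arc_sign_def orient_def a)
  finally show ?case by simp
qed simp

text \<open>The sign of a perfect matching, computed from any listing of its edges with arbitrary directions.
  For fixed \<open>es\<close> the orientation only enters through the product of the arc signs.\<close>

lemma matching_sign_listing:
  assumes enum: "enumeration G enum" and D: "orientation G D"
    and es: "listing (verts G) (flat es)" and M: "M = ends ` set es" "M \<subseteq> edges G"
  shows "matching_sign enum D M = prod_list (map (arc_sign D) es) * list_sign enum (flat es)"
proof -
  let ?fs = "map (orient D) es"
  define gs where "gs = (SOME gs. distinct gs \<and> set gs = matching_arcs D M)"
  have l: "listing (verts G) (flat ?fs)"
    using listing_mset[OF es] mset_flat_orient by metis
  have dist: "distinct ?fs"
  proof -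
    have "distinct (map ends ?fs)"
      using l by (intro distinct_ends) (simp add: listing_def)
    then show ?thesis by (simp only: distinct_map)
  qed
  have "set ?fs = matching_arcs D M"
  proof (intro set_eqI iffI)
    fix a assume "a \<in> set ?fs"
    then obtain b where b: "b \<in> set es" "a = orient D b" by auto
    have "ends b \<in> edges G" using b M by auto
    then have "a \<in> D" "ends a = ends b"
      using orientation_swap[OF D] b(2) by (auto simp: orient_def)
    moreover have "ends b \<in> M" using b M by auto
    ultimately show "a \<in> matching_arcs D M"
      by (cases a) (auto simp: matching_arcs_def ends_def)
  next
    fix a assume a: "a \<in> matching_arcs D M"
    then have aD: "a \<in> D" "ends a \<in> M" by (auto simp: matching_arcs_def ends_def)
    then obtain b where b: "b \<in> set es" "ends a = ends b" using M by auto
    have "orient D b = a"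
    proof (cases "a = b")
      case False
      then have sw: "b = prod.swap a"
        using b(2) by (cases a; cases b) (auto simp: ends_def doubleton_eq_iff)
      have "ends a \<in> edges G" using aD M by auto
      then have "b \<notin> D"
        using orientation_swap[OF D] aD(1) unfolding sw by simp
      then show ?thesis using sw by (simp add: orient_def)
    qed (use aD in \<open>simp add: orient_def\<close>)
    then show "a \<in> set ?fs" using b by auto
  qed
  with dist have "\<exists>gs. distinct gs \<and> set gs = matching_arcs D M" by blast
  then have gs: "distinct gs \<and> set gs = matching_arcs D M"
    unfolding gs_def by (rule someI_ex)
  then have "mset gs = mset ?fs"
    using dist \<open>set ?fs = matching_arcs D M\<close> by (metis set_eq_iff_mset_eq_distinct)
  then have "list_sign enum (flat ?fs) = list_sign enum (flat gs)"
    using list_sign_order[of enum "verts G" "[]" ?fs gs] enum l by (simp add: enumeration_def)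
  moreover have "matching_sign enum D M = list_sign enum (flat gs)"
    unfolding matching_sign_def list_sign_def Let_def gs_def[symmetric]
    by (simp add: flat_def map_concat comp_def case_prod_unfold)
  moreover have "list_sign enum (flat ?fs) = prod_list (map (arc_sign D) es) * list_sign enum (flat es)"
    using list_sign_orient[of enum "verts G" "[]" es D] enum es by (simp add: enumeration_def)
  ultimately show ?thesis by simp
qed

lemma disjoint_pairs_flat:
  assumes "distinct ms" and "\<forall>e\<in>set ms. card e = 2"
    and "\<forall>e\<in>set ms. \<forall>f\<in>set ms. e \<noteq> f \<longrightarrow> e \<inter> f = {}"
  shows "\<exists>es. distinct (flat es) \<and> set (flat es) = \<Union>(set ms) \<and> ends ` set es = set ms"
  using assms
proof (induction ms)
  case (Cons e ms)
  then obtain es where es: "distinct (flat es)" "set (flat es) = \<Union>(set ms)" "ends ` set es = set ms"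
    by auto
  obtain u v where e: "e = {u, v}" "u \<noteq> v" using Cons.prems(2) by (auto simp: card_2_iff)
  have "\<forall>f\<in>set ms. e \<inter> f = {}" using Cons.prems by auto
  then have "u \<notin> \<Union>(set ms)" "v \<notin> \<Union>(set ms)" using e by auto
  then have "distinct (flat ((u, v) # es)) \<and> set (flat ((u, v) # es)) = \<Union>(set (e # ms))
      \<and> ends ` set ((u, v) # es) = set (e # ms)"
    using es e by (auto simp: ends_def)
  then show ?case by blast
qed (auto intro: exI[of _ "[]"])

lemma perfect_matching_listing:
  assumes G: "simple_graph G" and M: "perfect_matching G M"
  obtains es where "listing (verts G) (flat es)" "M = ends ` set es"
proof -
  have edges: "e \<subseteq> verts G \<and> card e = 2" if "e \<in> M" for e
    using that G M by (auto simp: simple_graph_def perfect_matching_def)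
  have "M \<subseteq> Pow (verts G)" using edges by auto
  moreover have "finite (verts G)" using G by (simp add: simple_graph_def)
  ultimately have "finite M" by (meson finite_Pow_iff finite_subset)
  then obtain ms where ms: "distinct ms" "set ms = M" by (metis finite_distinct_list)
  have "\<forall>e\<in>M. \<forall>f\<in>M. e \<noteq> f \<longrightarrow> e \<inter> f = {}"
  proof (intro ballI impI)
    fix e f assume ef: "e \<in> M" "f \<in> M" "e \<noteq> f"
    have False if "v \<in> e" "v \<in> f" for v
    proof -
      have "v \<in> verts G" using edges[OF ef(1)] that by auto
      then show False using M ef that unfolding perfect_matching_def by blast
    qed
    then show "e \<inter> f = {}" by auto
  qed
  then obtain es where es: "distinct (flat es)" "set (flat es) = \<Union>M" "ends ` set es = M"
    using disjoint_pairs_flat[of ms] ms edges by auto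
  moreover have "\<Union>M = verts G"
    using M edges unfolding perfect_matching_def by blast
  ultimately show thesis using that by (simp add: listing_def)
qed

section \<open>Orthogonality of signs and existence of pfaffian vectors of orientations\<close>

text \<open>The orientation \<open>D\<close> with the edge \<open>e\<close> reversed.\<close>

definition reverse_edge :: "'a set \<Rightarrow> ('a \<times> 'a) set \<Rightarrow> ('a \<times> 'a) set" where
  "reverse_edge e D = {a. if ends a = e then prod.swap a \<in> D else a \<in> D}"

lemma reverse_edge_involution [simp]: "reverse_edge e (reverse_edge e D) = D"
  by (auto simp: reverse_edge_def)

lemma orientation_reverse_edge:
  assumes "orientation G D"
  shows "orientation G (reverse_edge e D)"
proof -
  have R: "(u, v) \<in> reverse_edge e D \<longleftrightarrow> (if {u, v} = e then (v, u) \<in> D else (u, v) \<in> D)" for u v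
    by (simp add: reverse_edge_def ends_def)
  have D: "{u, v} \<in> edges G" if "(u, v) \<in> D" for u v
    using assms that unfolding orientation_def by blast
  have D': "(u, v) \<in> D \<longleftrightarrow> (v, u) \<notin> D" if "{u, v} \<in> edges G" for u v
    using assms that unfolding orientation_def by blast
  have "{u, v} \<in> edges G" if "(u, v) \<in> reverse_edge e D" for u v
    using that D[of u v] D[of v u] insert_commute[of u v "{}"] by (simp add: R split: if_splits)
  moreover have "(u, v) \<in> reverse_edge e D \<longleftrightarrow> (v, u) \<notin> reverse_edge e D"
    if "{u, v} \<in> edges G" for u v
    using D'[OF that] insert_commute[of u v "{}"] by (auto simp: R)
  ultimately show ?thesis unfolding orientation_def by blast
qed

lemma matching_sign_reverse_edge:
  assumes G: "simple_graph G" and enum: "enumeration G enum" and D: "orientation G D"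
    and M: "perfect_matching G M"
  shows "matching_sign enum (reverse_edge e D) M = (if e \<in> M then -1 else 1) * matching_sign enum D M"
proof -
  obtain es where es: "listing (verts G) (flat es)" "M = ends ` set es"
    using perfect_matching_listing[OF G M] .
  have sub: "M \<subseteq> edges G" using M by (simp add: perfect_matching_def)
  have "arc_sign (reverse_edge e D) a = (if ends a = e then -1 else 1) * arc_sign D a"
    if "a \<in> set es" for a
  proof -
    have "ends a \<in> edges G" using that es sub by auto
    then have "prod.swap a \<in> D \<longleftrightarrow> a \<notin> D"
      using orientation_swap[OF D] by simp
    then show ?thesis by (simp add: arc_sign_def reverse_edge_def)
  qed
  then have "prod_list (map (arc_sign (reverse_edge e D)) es)
      = prod_list (map (\<lambda>a. (if ends a = e then -1 else 1) * arc_sign D a) es)"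
    by (intro arg_cong[of _ _ prod_list] map_cong) auto
  also have "\<dots> = prod_list (map (\<lambda>e'. if e' = e then -1 else 1) (map ends es)) * prod_list (map (arc_sign D) es)"
    by (induction es) auto
  also have "prod_list (map (\<lambda>e'. if e' = e then -1 else 1) (map ends es)) = (\<Prod>e'\<in>M. if e' = e then -1 else (1::int))"
  proof -
    have "distinct (map ends es)" using es(1) by (intro distinct_ends) (simp add: listing_def)
    from prod.distinct_set_conv_list[OF this] show ?thesis unfolding es(2) set_map by (rule sym)
  qed
  also have "\<dots> = (if e \<in> M then -1 else 1)"
  proof -
    have "finite M" unfolding es(2) by simp
    then show ?thesis by (simp add: prod.delta)
  qed
  finally show ?thesis
    using matching_sign_listing[OF enum D es sub]
      matching_sign_listing[OF enum orientation_reverse_edge[OF D] es sub] by simp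
qed

lemma matching_sign_square: "matching_sign enum D M * matching_sign enum D M = 1"
  by (simp add: matching_sign_def Let_def)

text \<open>Reversing an edge that lies in exactly one of the two matchings is an involution on the
  orientations that changes the sign of each summand.\<close>

lemma matching_sign_orthogonal:
  assumes G: "simple_graph G" and enum: "enumeration G enum"
    and M: "perfect_matching G M" "perfect_matching G M'" "M \<noteq> M'"
  shows "(\<Sum>D | orientation G D. matching_sign enum D M * matching_sign enum D M') = 0"
proof -
  obtain e where e: "e \<in> M \<longleftrightarrow> e \<notin> M'" using M(3) by auto
  let ?f = "\<lambda>D. matching_sign enum D M * matching_sign enum D M'"
  have "bij_betw (reverse_edge e) {D. orientation G D} {D. orientation G D}"
    by (rule bij_betw_byWitness[of _ "reverse_edge e"]) (auto intro: orientation_reverse_edge)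
  from sum.reindex_bij_betw[OF this, of ?f]
  have "sum ?f {D. orientation G D} = (\<Sum>D | orientation G D. ?f (reverse_edge e D))" by simp
  also have "\<dots> = (\<Sum>D | orientation G D. - ?f D)"
  proof (intro sum.cong refl)
    fix D assume "D \<in> {D. orientation G D}"
    then have D: "orientation G D" by simp
    show "?f (reverse_edge e D) = - ?f D"
      unfolding matching_sign_reverse_edge[OF G enum D M(1)] matching_sign_reverse_edge[OF G enum D M(2)]
      using e by (cases "e \<in> M") simp_all
  qed
  also have "\<dots> = - sum ?f {D. orientation G D}" by (rule sum_negf)
  finally show ?thesis by linarith
qed

text \<open>The vector of all orientations is pfaffian. By orthogonality, a solution is obtained by giving each
  orientation \<open>D\<close> the weight \<open>\<Sum>\<^sub>M\<^sub>' sign\<^sub>D(M')\<close> divided by the number of orientations.\<close>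

lemma ex_k_pfaffian:
  assumes G: "simple_graph G"
  shows "\<exists>k>0. k_pfaffian k G"
proof -
  have finV: "finite (verts G)" using G by (simp add: simple_graph_def)
  obtain f where f: "bij_betw f {1..card (verts G)} (verts G)"
    using ex_bij_betw_nat_finite_1[OF finV] by auto
  obtain enum where enum: "enumeration G enum"
    using bij_betw_the_inv_into[OF f] unfolding enumeration_def by blast
  let ?O = "{D. orientation G D}" and ?PM = "{M. perfect_matching G M}"
  have edge: "e \<subseteq> verts G" "card e = 2" if "e \<in> edges G" for e
    using G that by (auto simp: simple_graph_def)
  have "D \<subseteq> verts G \<times> verts G" if "orientation G D" for D
  proof
    fix a assume "a \<in> D"
    then have "{fst a, snd a} \<in> edges G" using that by (auto simp: orientation_def)
    from edge(1)[OF this] show "a \<in> verts G \<times> verts G" by (simp add: mem_Times_iff)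
  qed
  then have "?O \<subseteq> Pow (verts G \<times> verts G)" by auto
  then have finO: "finite ?O" using finV by (meson finite_Pow_iff finite_SigmaI finite_subset)
  have "?PM \<subseteq> Pow (Pow (verts G))"
    using edge(1) by (auto simp: perfect_matching_def)
  then have finPM: "finite ?PM" using finV by (meson finite_Pow_iff finite_subset)
  \<comment> \<open>Some orientation exists, so that the vector is not empty.\<close>
  let ?D0 = "{(u, v). {u, v} \<in> edges G \<and> enum u < enum v}"
  have "enum u \<noteq> enum v" if "{u, v} \<in> edges G" for u v
  proof -
    have "u \<in> verts G" "v \<in> verts G" "card {u, v} = 2"
      using edge[OF that] by auto
    then have "u \<noteq> v" by auto
    with \<open>u \<in> verts G\<close> \<open>v \<in> verts G\<close> show ?thesis
      using enum by (auto simp: enumeration_def bij_betw_def inj_on_def)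
  qed
  then have "(u, v) \<in> ?D0 \<longleftrightarrow> (v, u) \<notin> ?D0" if "{u, v} \<in> edges G" for u v
    using that insert_commute[of u v "{}"] by fastforce
  then have "orientation G ?D0" unfolding orientation_def by blast
  then have cardO: "card ?O > 0" using finO by (subst card_gt_0_iff) blast
  obtain h where h: "bij_betw h {1..card ?O} ?O"
    using ex_bij_betw_nat_finite_1[OF finO] by blast
  let ?s = "\<lambda>D M. real_of_int (matching_sign enum D M)"
  define x where "x i = (\<Sum>M'\<in>?PM. ?s (h i) M') / card ?O" for i
  have "(\<Sum>i = 1..card ?O. signature_matrix enum h M i * x i) = 1" if M: "perfect_matching G M" for M
  proof -
    have "(\<Sum>i = 1..card ?O. signature_matrix enum h M i * x i)
       = (\<Sum>i = 1..card ?O. (\<lambda>D. ?s D M * (\<Sum>M'\<in>?PM. ?s D M')) (h i)) / card ?O"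
      unfolding sum_divide_distrib[where A = "{1..card ?O}"] by (simp add: signature_matrix_def x_def)
    also have "(\<Sum>i = 1..card ?O. (\<lambda>D. ?s D M * (\<Sum>M'\<in>?PM. ?s D M')) (h i))
       = (\<Sum>D\<in>?O. ?s D M * (\<Sum>M'\<in>?PM. ?s D M'))"
      using h by (rule sum.reindex_bij_betw)
    also have "\<dots> = (\<Sum>M'\<in>?PM. \<Sum>D\<in>?O. ?s D M * ?s D M')"
      unfolding sum_distrib_left by (rule sum.swap)
    also have "\<dots> = (\<Sum>M'\<in>?PM. if M' = M then real (card ?O) else 0)"
    proof (intro sum.cong refl)
      fix M' assume M': "M' \<in> ?PM"
      have "(\<Sum>D\<in>?O. ?s D M * ?s D M')
        = real_of_int (\<Sum>D\<in>?O. matching_sign enum D M * matching_sign enum D M')" by simp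
      also have "\<dots> = (if M' = M then real (card ?O) else 0)"
      proof (cases "M' = M")
        case True
        then show ?thesis unfolding True matching_sign_square by simp
      next
        case False
        then show ?thesis using matching_sign_orthogonal[OF G enum M, of M'] M' by simp
      qed
      finally show "(\<Sum>D\<in>?O. ?s D M * ?s D M') = (if M' = M then real (card ?O) else 0)" .
    qed
    also have "\<dots> = card ?O" using M finPM by simp
    finally show ?thesis using cardO by simp
  qed
  then have "pfaffian G enum (card ?O) h" unfolding pfaffian_def by blast
  moreover have "k_orientation G (card ?O) h"
    using bij_betwE[OF h] by (auto simp: k_orientation_def)
  ultimately show ?thesis using enum cardO unfolding k_pfaffian_def by blast
qed

section \<open>Perfect matchings of the Vyalyi graphs\<close>

lemma perfect_matching_ends:
  assumes es: "listing (verts G) (flat es)" and sub: "ends ` set es \<subseteq> edges G"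
  shows "perfect_matching G (ends ` set es)"
proof -
  have unique: "a = b" if "a \<in> set es" "b \<in> set es" "v \<in> ends a" "v \<in> ends b" for a b v
  proof -
    have "distinct (flat es)" using es by (simp add: listing_def)
    then show ?thesis using that
    proof (induction es)
      case (Cons c es)
      obtain x y where c: "c = (x, y)" by fastforce
      have dist: "distinct (flat es)" and "x \<notin> set (flat es)" "y \<notin> set (flat es)"
        using Cons.prems(1) unfolding c by simp_all
      then have "v \<notin> ends c" if "d \<in> set es" "v \<in> ends d" for d
        using that unfolding set_flat c ends_def by auto
      then show ?case using Cons.prems(2-) Cons.IH[OF dist] by (metis set_ConsD)
    qed simp
  qed
  have cover: "verts G = (\<Union>a\<in>set es. ends a)"
    using es by (simp add: listing_def set_flat)
  show ?thesis
    unfolding perfect_matching_def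
  proof (intro conjI ballI sub)
    fix v assume "v \<in> verts G"
    then obtain a where a: "a \<in> set es" "v \<in> ends a" using cover by auto
    show "\<exists>!e. e \<in> ends ` set es \<and> v \<in> e"
      by (rule ex1I[of _ "ends a"]) (use a unique[OF a(1) _ a(2)] in blast)+
  qed
qed

text \<open>The six perfect matchings of \<open>H\<close>, which correspond to those of \<open>K\<^sub>3\<^sub>,\<^sub>3\<close>: an edge replaced by a path is
  used if and only if the two outer edges of the path are. All arcs are directed from the colour
  class \<open>A1, A2, A3, v, p\<close> to the other one, with the first vertices always in this order. The
  matchings are indexed by \<open>{..<6}\<close>; number \<open>0\<close> serves as the reference.\<close>

definition H_matching :: "nat \<Rightarrow> (H_vertex \<times> H_vertex) list" where
  "H_matching r =
    [[(A1, B2), (A2, B1), (A3, B3), (Hv, Hu), (Hp, Hq)],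
     [(A1, Hu), (A2, Hq), (A3, B3), (Hv, B1), (Hp, B2)],
     [(A1, B3), (A2, Hq), (A3, B1), (Hv, Hu), (Hp, B2)],
     [(A1, Hu), (A2, B3), (A3, B2), (Hv, B1), (Hp, Hq)],
     [(A1, B2), (A2, B3), (A3, B1), (Hv, Hu), (Hp, Hq)],
     [(A1, B3), (A2, B1), (A3, B2), (Hv, Hu), (Hp, Hq)]] ! r"

lemma less_6_cases: "r \<in> {..<6} \<Longrightarrow> r \<in> {0, 1, 2, 3, 4, 5 :: nat}"
  by auto

text \<open>The sign of the permutation that leads from matching \<open>0\<close> to matching \<open>r\<close>. It is \<open>-1\<close> for all other
  five matchings: each use of a subdivided edge changes the sign of the permutation in \<open>K\<^sub>3\<^sub>,\<^sub>3\<close>.\<close>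

definition H_sign :: "nat \<Rightarrow> int" where
  "H_sign r = (if r = 0 then 1 else -1)"

lemma H_matching_listing:
  assumes "r \<in> {..<6}"
  shows "listing UNIV (flat (H_matching r))"
  using less_6_cases[OF assms]
  by (auto simp: listing_def H_matching_def UNIV_H_vertex)

lemma H_edge: "a \<in> {A1, A2, A3} \<Longrightarrow> b \<in> {B1, B2, B3} \<Longrightarrow> (a, b) \<noteq> (A1, B1) \<Longrightarrow> (a, b) \<noteq> (A2, B2) \<Longrightarrow>
  {a, b} \<in> H_edges"
proof -
  assume *: "a \<in> {A1, A2, A3}" "b \<in> {B1, B2, B3}" "(a, b) \<noteq> (A1, B1)" "(a, b) \<noteq> (A2, B2)"
  then have "{a, b} \<in> K33_edges" unfolding K33_edges_def by blast
  moreover have "{a, b} \<noteq> {A1, B1}" "{a, b} \<noteq> {A2, B2}"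
    unfolding doubleton_eq_iff using * by auto
  ultimately show ?thesis unfolding H_edges_def by simp
qed

lemma H_path_edge: "{A1, Hu} \<in> H_edges" "{Hu, Hv} \<in> H_edges" "{Hv, B1} \<in> H_edges"
    "{A2, Hq} \<in> H_edges" "{Hq, Hp} \<in> H_edges" "{Hp, B2} \<in> H_edges"
  unfolding H_edges_def by simp_all

lemma H_matching_edges:
  assumes "r \<in> {..<6}" and "a \<in> set (H_matching r)"
  shows "{fst a, snd a} \<in> H_edges"
proof -
  have "\<forall>a\<in>set (H_matching r). {fst a, snd a} \<in> H_edges"
    using less_6_cases[OF assms(1)]
    unfolding insert_iff empty_iff simp_thms
    by (elim disjE) (simp_all add: H_matching_def H_edge H_path_edge insert_commute[of Hv Hu] insert_commute[of Hp Hq])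
  then show ?thesis using assms(2) by blast
qed

text \<open>The perfect matching of \<open>V\<^sub>n\<close> that avoids the edges between the copies of \<open>H\<close> and whose part in copy
  \<open>j + 1\<close> is matching number \<open>\<rho> j\<close>. Blocks are counted from \<open>0\<close>, copies of \<open>H\<close> from \<open>1\<close>.\<close>

definition V_matching :: "nat \<Rightarrow> (nat \<Rightarrow> nat) \<Rightarrow> ((nat \<times> H_vertex) \<times> (nat \<times> H_vertex)) list" where
  "V_matching n \<rho> = concat (map (\<lambda>j. map (map_prod (Pair (Suc j)) (Pair (Suc j))) (H_matching (\<rho> j))) [0..<n])"

lemma flat_map_prod: "flat (map (map_prod f f) es) = map f (flat es)"
  by (induction es) auto

lemma V_matching_0 [simp]: "V_matching 0 \<rho> = []"
  by (simp add: V_matching_def)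

lemma V_matching_Suc [simp]:
  "V_matching (Suc n) \<rho> = V_matching n \<rho> @ map (map_prod (Pair (Suc n)) (Pair (Suc n))) (H_matching (\<rho> n))"
  by (simp add: V_matching_def)

lemma V_matching_listing:
  assumes "range \<rho> \<subseteq> {..<6}"
  shows "listing ({1..n} \<times> UNIV) (flat (V_matching n \<rho>))"
proof (induction n)
  case (Suc n)
  have "listing UNIV (flat (H_matching (\<rho> n)))"
    using assms by (intro H_matching_listing) auto
  moreover have "{1..Suc n} = insert (Suc n) {1..n}" by auto
  ultimately show ?case
    using Suc.IH by (auto simp: listing_def flat_map_prod distinct_map inj_on_def)
qed (simp add: listing_def)

lemma V_matching_perfect:
  assumes "range \<rho> \<subseteq> {..<6}"
  shows "perfect_matching (vyalyi n) (ends ` set (V_matching n \<rho>))"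
proof (rule perfect_matching_ends)
  show "listing (verts (vyalyi n)) (flat (V_matching n \<rho>))"
    using V_matching_listing[OF assms] by (simp add: vyalyi_def)
  have "\<exists>i x y. ends a = {(i, x), (i, y)} \<and> i \<in> {1..n} \<and> {x, y} \<in> H_edges"
    if a: "a \<in> set (V_matching n \<rho>)" for a
  proof -
    obtain j p where "j < n" "p \<in> set (H_matching (\<rho> j))" "a = map_prod (Pair (Suc j)) (Pair (Suc j)) p"
      using a by (auto simp: V_matching_def)
    moreover have "\<rho> j \<in> {..<6}" using assms by auto
    ultimately have "ends a = {(Suc j, fst p), (Suc j, snd p)} \<and> Suc j \<in> {1..n} \<and> {fst p, snd p} \<in> H_edges"
      using H_matching_edges by (simp add: ends_def)
    then show ?thesis by blast
  qed
  then show "ends ` set (V_matching n \<rho>) \<subseteq> edges (vyalyi n)"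
    by (auto simp: vyalyi_def)
qed

lemma list_sign_transpose_block:
  assumes enum: "bij_betw enum V {1..card V}" and "inj f"
    and vs: "listing V (us @ map f zs @ ws)"
    and "\<forall>(x, y)\<in>set ts. x \<in> set zs \<and> y \<in> set zs \<and> x \<noteq> y"
  shows "list_sign enum (us @ map f (foldr (\<lambda>(x, y). map (transpose x y)) ts zs) @ ws)
      = (-1) ^ length ts * list_sign enum (us @ map f zs @ ws)
    \<and> listing V (us @ map f (foldr (\<lambda>(x, y). map (transpose x y)) ts zs) @ ws)
    \<and> set (foldr (\<lambda>(x, y). map (transpose x y)) ts zs) = set zs"
  using assms(4)
proof (induction ts)
  case Nil
  then show ?case using vs by simp
next
  case (Cons t ts)
  obtain x y where t: "t = (x, y)" by fastforce
  define zs' where "zs' = foldr (\<lambda>(x, y). map (transpose x y)) ts zs"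
  let ?vs = "us @ map f zs' @ ws"
  have IH: "list_sign enum ?vs = (-1) ^ length ts * list_sign enum (us @ map f zs @ ws)"
    "listing V ?vs" "set zs' = set zs"
    using Cons.IH Cons.prems by (auto simp: zs'_def)
  have xy: "x \<in> set zs'" "y \<in> set zs'" "x \<noteq> y" using Cons.prems IH(3) by (auto simp: t)
  have fixed: "map (transpose (f x) (f y)) qs = qs" if "f x \<notin> set qs" "f y \<notin> set qs" for qs
    using that by (induction qs) (auto simp: transpose_def)
  have "map (transpose (f x) (f y)) us = us" "map (transpose (f x) (f y)) ws = ws"
    by (rule fixed; use IH(2) xy in \<open>auto simp: listing_def\<close>)+
  then have moved: "map (transpose (f x) (f y)) ?vs = us @ map f (map (transpose x y) zs') @ ws"
    using \<open>inj f\<close> by (auto simp: transpose_def inj_eq)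
  have fxy: "f x \<in> V" "f y \<in> V" "f x \<noteq> f y"
    using IH(2) xy \<open>inj f\<close> by (auto simp: listing_def inj_eq)
  have l: "listing V (map (transpose (f x) (f y)) ?vs)"
  proof -
    have "transpose (f x) (f y) ` V = V" using fxy by simp
    then show ?thesis using IH(2) unfolding listing_def
      by (metis distinct_map inj_on_transpose list.set_map)
  qed
  have fold: "foldr (\<lambda>(x, y). map (transpose x y)) (t # ts) zs = map (transpose x y) zs'"
    by (simp add: t zs'_def)
  have "set (map (transpose x y) zs') = set zs"
    using xy IH(3) by simp
  moreover have "list_sign enum (map (transpose (f x) (f y)) ?vs)
      = (-1) ^ length (t # ts) * list_sign enum (us @ map f zs @ ws)"
    using list_sign_transpose[OF enum IH(2) fxy] IH(1) by simp
  ultimately show ?case using l unfolding fold moved by blast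
qed

text \<open>A product of transpositions, composed from right to left, that takes the vertex list of matching
  \<open>0\<close> to that of matching \<open>r\<close>.\<close>

definition H_cycle :: "nat \<Rightarrow> (H_vertex \<times> H_vertex) list" where
  "H_cycle r =
    [[], [(B2, Hu), (Hu, B1), (B1, Hq)], [(B2, B3), (B3, B1), (B1, Hq)],
     [(B2, Hu), (Hu, B1), (B1, B3)], [(B1, B3)], [(B2, B3)]] ! r"

lemma list_sign_H_matching:
  assumes enum: "bij_betw enum V {1..card V}" and "inj f" and r: "r \<in> {..<6}"
    and vs: "listing V (us @ map f (flat (H_matching r)) @ ws)"
  shows "list_sign enum (us @ map f (flat (H_matching r)) @ ws)
      = H_sign r * list_sign enum (us @ map f (flat (H_matching 0)) @ ws)"
proof -
  have foldr: "foldr (\<lambda>(x, y). map (transpose x y)) (H_cycle r) (flat (H_matching 0)) = flat (H_matching r)"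
    using less_6_cases[OF r] unfolding insert_iff empty_iff simp_thms
    by (elim disjE) (simp_all add: H_matching_def H_cycle_def transpose_def)
  have "mset (flat (H_matching r)) = mset (flat (H_matching 0))"
    using H_matching_listing[OF r] H_matching_listing[of 0]
    by (simp add: listing_def set_eq_iff_mset_eq_distinct[symmetric])
  then have l0: "listing V (us @ map f (flat (H_matching 0)) @ ws)"
    by (intro listing_mset[OF vs]) simp
  have "\<forall>(x, y)\<in>set (H_cycle r). x \<in> set (flat (H_matching 0)) \<and> y \<in> set (flat (H_matching 0)) \<and> x \<noteq> y"
    using less_6_cases[OF r] unfolding insert_iff empty_iff simp_thms
    by (elim disjE) (simp_all add: H_matching_def H_cycle_def)
  from list_sign_transpose_block[OF enum \<open>inj f\<close> l0 this]
  have "list_sign enum (us @ map f (flat (H_matching r)) @ ws)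
      = (-1) ^ length (H_cycle r) * list_sign enum (us @ map f (flat (H_matching 0)) @ ws)"
    unfolding foldr by simp
  moreover have "(-1) ^ length (H_cycle r) = H_sign r"
    using less_6_cases[OF r] unfolding insert_iff empty_iff simp_thms
    by (elim disjE) (simp_all add: H_cycle_def H_sign_def)
  ultimately show ?thesis by simp
qed

lemma list_sign_V_matching:
  assumes enum: "bij_betw enum V {1..card V}" and \<rho>: "range \<rho> \<subseteq> {..<6}"
    and "listing V (flat (V_matching n \<rho>) @ ws)"
  shows "list_sign enum (flat (V_matching n \<rho>) @ ws)
     = (\<Prod>j<n. H_sign (\<rho> j)) * list_sign enum (flat (V_matching n (\<lambda>_. 0)) @ ws)"
  using assms(3)
proof (induction n arbitrary: ws)
  case (Suc n)
  let ?b = "\<lambda>r. map (Pair (Suc n)) (flat (H_matching r))"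
  have r: "\<rho> n \<in> {..<6}" using \<rho> by auto
  have l: "listing V (flat (V_matching n \<rho>) @ ?b (\<rho> n) @ ws)"
    using Suc.prems by (simp add: flat_map_prod)
  have "mset (flat (H_matching (\<rho> n))) = mset (flat (H_matching 0))"
    using H_matching_listing[OF r] H_matching_listing[of 0]
    by (simp add: listing_def set_eq_iff_mset_eq_distinct[symmetric])
  then have l0: "listing V (flat (V_matching n \<rho>) @ ?b 0 @ ws)"
    by (intro listing_mset[OF l]) simp
  have "list_sign enum (flat (V_matching n \<rho>) @ ?b (\<rho> n) @ ws)
     = H_sign (\<rho> n) * list_sign enum (flat (V_matching n \<rho>) @ ?b 0 @ ws)"
    using l by (intro list_sign_H_matching[OF enum _ r]) (auto simp: inj_def)
  then show ?case using Suc.IH[OF l0] by (simp add: flat_map_prod)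
qed simp

text \<open>The contribution of block \<open>j\<close> to the sign, if matching \<open>r\<close> is chosen in it.\<close>

definition block_sign :: "((nat \<times> H_vertex) \<times> (nat \<times> H_vertex)) set \<Rightarrow> nat \<Rightarrow> nat \<Rightarrow> int" where
  "block_sign D j r = H_sign r *
     prod_list (map (arc_sign D) (map (map_prod (Pair (Suc j)) (Pair (Suc j))) (H_matching r)))"

lemma matching_sign_V_matching:
  assumes enum: "enumeration (vyalyi n) enum" and D: "orientation (vyalyi n) D"
    and \<rho>: "range \<rho> \<subseteq> {..<6}"
  shows "matching_sign enum D (ends ` set (V_matching n \<rho>))
     = list_sign enum (flat (V_matching n (\<lambda>_. 0))) * (\<Prod>j<n. block_sign D j (\<rho> j))"
proof -
  have l: "listing (verts (vyalyi n)) (flat (V_matching n \<rho>))"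
    using V_matching_listing[OF \<rho>] by (simp add: vyalyi_def)
  have "ends ` set (V_matching n \<rho>) \<subseteq> edges (vyalyi n)"
    using V_matching_perfect[OF \<rho>] by (simp add: perfect_matching_def)
  from matching_sign_listing[OF enum D l refl this]
  have "matching_sign enum D (ends ` set (V_matching n \<rho>))
      = prod_list (map (arc_sign D) (V_matching n \<rho>)) * list_sign enum (flat (V_matching n \<rho>))" .
  also have "prod_list (map (arc_sign D) (V_matching n \<rho>))
    = (\<Prod>j<n. prod_list (map (arc_sign D) (map (map_prod (Pair (Suc j)) (Pair (Suc j))) (H_matching (\<rho> j)))))"
    by (induction n) auto
  also have "list_sign enum (flat (V_matching n \<rho>))
    = (\<Prod>j<n. H_sign (\<rho> j)) * list_sign enum (flat (V_matching n (\<lambda>_. 0)))"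
    using list_sign_V_matching[of enum "verts (vyalyi n)" \<rho> n "[]"] enum \<rho> l
    by (simp add: enumeration_def)
  finally show ?thesis by (simp add: block_sign_def prod.distrib mult_ac)
qed

lemma arc_sign_square: "arc_sign D a * arc_sign D a = 1" "arc_sign D a * (arc_sign D a * c) = c"
  by (simp_all add: arc_sign_def)

lemma block_sign_pm1: "block_sign D j r \<in> {-1, 1}"
proof -
  have "prod_list (map (arc_sign D) es) \<in> {-1, 1}" for es
    by (induction es) (auto simp: arc_sign_def)
  from this[of "map (map_prod (Pair (Suc j)) (Pair (Suc j))) (H_matching r)"] show ?thesis
    by (auto simp: block_sign_def H_sign_def)
qed

text \<open>Each edge of \<open>H\<close> lies in an even number (two or four) of the six matchings, so the orientation
  cancels, and the five factors \<open>H_sign r = -1\<close> remain.\<close>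

lemma prod_block_sign: "(\<Prod>r<6. block_sign D j r) = -1"
proof -
  have "{..<6} = {0, 1, 2, 3, 4, 5 :: nat}" by auto
  then show ?thesis
    by (simp add: block_sign_def H_sign_def H_matching_def arc_sign_square mult_ac)
qed

lemma k_pfaffian_vyalyi_bound:
  assumes "k_pfaffian k (vyalyi n)"
  shows "3 * n + 1 \<le> k"
proof -
  obtain enum D x where enum: "enumeration (vyalyi n) enum" and D: "k_orientation (vyalyi n) k D"
    and x: "\<And>M. perfect_matching (vyalyi n) M \<Longrightarrow> (\<Sum>i = 1..k. signature_matrix enum D M i * x i) = 1"
    using assms unfolding k_pfaffian_def pfaffian_def by blast
  define c where "c = real_of_int (list_sign enum (flat (V_matching n (\<lambda>_. 0))))"
  have "3 * n + 1 \<le> card {1..k}"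
  proof (rule blocks_bound[where R = "{..<6}" and x = "\<lambda>i. c * x i"
        and b = "\<lambda>i j r. real_of_int (block_sign (D i) j r)"])
    show "real_of_int (block_sign (D i) j r) \<in> {-1, 1}" for i j r
      using block_sign_pm1[of "D i" j r] by auto
    show "(\<Prod>r<6. real_of_int (block_sign (D i) j r)) = -1" for i j
      using prod_block_sign[of "D i" j] by (simp flip: of_int_prod)
  next
    fix \<rho> :: "nat \<Rightarrow> nat" assume \<rho>: "range \<rho> \<subseteq> {..<6}"
    have "(\<Sum>i = 1..k. c * x i * (\<Prod>j<n. real_of_int (block_sign (D i) j (\<rho> j))))
       = (\<Sum>i = 1..k. signature_matrix enum D (ends ` set (V_matching n \<rho>)) i * x i)"
    proof (intro sum.cong refl)
      fix i assume "i \<in> {1..k}"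
      then have "orientation (vyalyi n) (D i)" using D by (simp add: k_orientation_def)
      from matching_sign_V_matching[OF enum this \<rho>]
      show "c * x i * (\<Prod>j<n. real_of_int (block_sign (D i) j (\<rho> j)))
        = signature_matrix enum D (ends ` set (V_matching n \<rho>)) i * x i"
        by (simp add: signature_matrix_def c_def)
    qed
    also have "\<dots> = 1" by (rule x[OF V_matching_perfect[OF \<rho>]])
    finally show "(\<Sum>i = 1..k. c * x i * (\<Prod>j<n. real_of_int (block_sign (D i) j (\<rho> j)))) = 1" .
  qed (auto simp: lessThan_empty_iff)
  then show ?thesis by simp
qed

theorem mainTheorem6:
  fixes n :: nat
  assumes "n \<ge> 1"
  shows "pf (vyalyi n) \<ge> 3 * n + 1"
proof -
  \<comment> \<open>Without a witness the least element in the definition of \<open>pf\<close> would be unspecified.\<close>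
  have "\<exists>k. 0 < k \<and> k_pfaffian k (vyalyi n)"
    using ex_k_pfaffian[OF simple_graph_vyalyi[OF assms]] by auto
  then have "k_pfaffian (pf (vyalyi n)) (vyalyi n)"
    unfolding pf_def by (metis (mono_tags, lifting) LeastI_ex)
  then show ?thesis by (rule k_pfaffian_vyalyi_bound)
qed

end
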